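(* Let $0=t_0<t_1<\cdots<t_N=T$ be a (possibly nonuniform) grid with $\tau_n=t_n-t_{n-1}$. Let $u_0\in\mathbb{R}$ and let $f:\mathbb{R}\to\mathbb{R}$ be smooth and Lipschitz continuous with $|f'(u)|\le M$ for all $u$, for some $M>0$. Let $A=(a_{n-j}^n)$, with $a_{n-j}^n=\bar a_{n-j}^n\tau_j$, be an array kernel that is local R-CMM with range $N$, and suppose $M\sup_{1\le j\le N}a_0^j=M\sup_{1\le j\le N}\tau_j\bar a_0^j<1$. Then the numerical solution $\{u_n\}$ of $$u_n=u_0+\sum_{j=1}^n a_{n-j}^n f(u_j),\qquad 1\le n\le N,$$ is monotone for all $0\le n\le N$ (i.e. the finite sequence $u_0,u_1,\dots,u_N$ is either nondecreasing or nonincreasing).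
   Context: An array kernel $A=(a_{n-j}^n)_{1\le j\le n}$ is a lower triangular real array whose entry in row $n$ and column $j$ is $a_{n-j}^n$ (so $a_0^n$ are the diagonal entries). The pseudo-convolution $C=A\bar{*}B$ of two array kernels is $c_{n-k}^n=\sum_{j=k}^n a_{n-j}^n b_{j-k}^j$ for $1\le k\le n$ (the product of lower triangular matrices). Row $n$ of the product depends only on rows $\le n$, so finite arrays ($n\le N$) are allowed. $L$ is the array kernel with all entries (on and below the diagonal) equal to $1$. The right complementary kernel $C_R$ of $A$ is the array kernel with $A\bar{*}C_R=L$. An array kernel $A=(a_{n-j}^n)$ is column monotone if its entries are nonnegative and $a_{j-1}^{n-1}\ge a_j^n$ for all $1\le j\le n-1$; it is row monotone if its entries are nonnegative and $a_{j-1}^n\ge a_j^n$ for all $1\le j\le n-1$; it is doubly monotone if it is both. $A$ is local R-CMM (right complementary monotone) with range $N$ if, for rows $n\le N$, $A$ is column monotone and $C_R$ exists and is doubly monotone. *)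

theory Defs
  imports "HOL-Analysis.Analysis"
begin

text \<open>
  An array kernel is a function \<open>A\<close> with \<open>A n i\<close> standing for $a_i^n$: \<open>n \<ge> 1\<close> is the row and
  \<open>i < n\<close> the offset from the diagonal, so the entry in row \<open>n\<close> and column \<open>j\<close> is
  \<open>A n (n - j)\<close>. Values with \<open>n = 0\<close> or \<open>i \<ge> n\<close> carry no meaning. All notions below are
  restricted to the rows \<open>1 \<le> n \<le> N\<close>.
\<close>

type_synonym array_kernel = "nat \<Rightarrow> nat \<Rightarrow> real"

text \<open>Offset \<open>i\<close> of row \<open>n\<close> is column \<open>k = n - i\<close> of the product.\<close>

definition pseudo_conv :: "array_kernel \<Rightarrow> array_kernel \<Rightarrow> array_kernel" where
  "pseudo_conv A B n i = (\<Sum>j = n - i..n. A n (n - j) * B j (j - (n - i)))"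

definition ones_kernel :: array_kernel where
  "ones_kernel n i = 1"

definition right_complementary :: "nat \<Rightarrow> array_kernel \<Rightarrow> array_kernel \<Rightarrow> bool" where
  "right_complementary N A C \<longleftrightarrow>
     (\<forall>n\<in>{1..N}. \<forall>k\<in>{1..n}. pseudo_conv A C n (n - k) = ones_kernel n (n - k))"

definition nonneg_kernel :: "nat \<Rightarrow> array_kernel \<Rightarrow> bool" where
  "nonneg_kernel N A \<longleftrightarrow> (\<forall>n\<in>{1..N}. \<forall>j\<in>{1..n}. A n (n - j) \<ge> 0)"

definition column_monotone :: "nat \<Rightarrow> array_kernel \<Rightarrow> bool" where
  "column_monotone N A \<longleftrightarrow>
     nonneg_kernel N A \<and> (\<forall>n\<in>{1..N}. \<forall>j\<in>{1..n - 1}. A (n - 1) (j - 1) \<ge> A n j)"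

definition row_monotone :: "nat \<Rightarrow> array_kernel \<Rightarrow> bool" where
  "row_monotone N A \<longleftrightarrow>
     nonneg_kernel N A \<and> (\<forall>n\<in>{1..N}. \<forall>j\<in>{1..n - 1}. A n (j - 1) \<ge> A n j)"

definition doubly_monotone :: "nat \<Rightarrow> array_kernel \<Rightarrow> bool" where
  "doubly_monotone N A \<longleftrightarrow> column_monotone N A \<and> row_monotone N A"

text \<open>
  A right complementary kernel is unique on the rows \<open>1 \<le> n \<le> N\<close> when it exists, since then
  the diagonal of \<open>A\<close> does not vanish there; the existential quantifier thus speaks about
  \<^emph>\<open>the\<close> kernel $C_R$.
\<close>

definition local_R_CMM :: "nat \<Rightarrow> array_kernel \<Rightarrow> bool" where
  "local_R_CMM N A \<longleftrightarrow>
     column_monotone N A \<and> (\<exists>C. right_complementary N A C \<and> doubly_monotone N C)"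

definition smooth :: "(real \<Rightarrow> real) \<Rightarrow> bool" where
  "smooth f \<longleftrightarrow> (\<forall>k x. (deriv ^^ k) f differentiable at x)"

end

theory Submission
  imports Defs
begin

text \<open>
  Write $w_k = u_k - u_{k-1}$ for the increments of the solution and $C$ for the right
  complementary kernel of $A$. Since $A \bar{*} C = L$ and multiplication by $L$ is summation, the
  scheme $A f(u) = u - u_0 = L w$ says $A f(u) = A (C w)$, and the diagonal of $A$ does not
  vanish, so $f(u) = C w$ (\<open>solve_by_right_complementary\<close>): the complementary kernel turns the
  Volterra equation into a formula of differential type,
  $f(u_n) = \sum_{k=1}^n c_{n-k}^n w_k$.

  Subtracting this formula for \<open>n - 1\<close> from the one for \<open>n\<close>, and writing
  $f(u_n) - f(u_{n-1}) = d_n w_n$ with $|d_n| \le M$ by the mean value theorem, gives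
  \[ (c_0^n - d_n)\, w_n = \sum_{k=1}^{n-1} (c_{n-1-k}^{n-1} - c_{n-k}^n)\, w_k . \]
  The coefficients on the right are nonnegative because \<open>C\<close> is column monotone, and the one on
  the left is positive because $c_0^n = 1 / a_0^n > M$. So each increment inherits the common sign
  of the previous ones, and all of them have the sign of $w_1$
  (\<open>increments_keep_sign\<close>).
\<close>

lemma right_complementary_sum:
  assumes "right_complementary N A C" "k \<in> {1..n}" "n \<le> N"
  shows "(\<Sum>j = k..n. A n (n - j) * C j (j - k)) = 1"
proof -
  have "n \<in> {1..N}"
    using assms(2,3) by auto
  then have "pseudo_conv A C n (n - k) = 1"
    using assms(1,2) by (simp add: right_complementary_def ones_kernel_def)
  then show ?thesis
    using assms(2) by (simp add: pseudo_conv_def)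
qed

lemma right_complementary_diag:
  assumes "right_complementary N A C" "n \<in> {1..N}"
  shows "A n 0 * C n 0 = 1"
  using right_complementary_sum[OF assms(1), of n n] assms(2) by simp

lemma lower_triangular_inj:
  fixes A :: array_kernel
  assumes diag: "\<And>n. n \<in> {1..N} \<Longrightarrow> A n 0 \<noteq> 0"
    and eq: "\<And>n. n \<in> {1..N} \<Longrightarrow>
      (\<Sum>j = 1..n. A n (n - j) * x j) = (\<Sum>j = 1..n. A n (n - j) * y j)"
    and "n \<in> {1..N}"
  shows "x n = y n"
  using \<open>n \<in> {1..N}\<close>
proof (induction n rule: less_induct)
  case (less n)
  then obtain m where m: "n = Suc m"
    by (cases n) auto
  have "(\<Sum>j = 1..m. A n (n - j) * x j) = (\<Sum>j = 1..m. A n (n - j) * y j)"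
    using less m by (intro sum.cong) auto
  with eq[OF less.prems] have "A n 0 * x n = A n 0 * y n"
    by (simp add: m)
  with diag[OF less.prems] show ?case
    by simp
qed

text \<open>
  The discrete counterpart of inverting an integral operator: \<open>C\<close> applied to the backward
  differences of \<open>v\<close> undoes \<open>A\<close>, because applying \<open>A\<close> to it gives, by associativity, the
  kernel \<open>L\<close> applied to the differences, a telescoping sum.
\<close>

lemma solve_by_right_complementary:
  fixes g v :: "nat \<Rightarrow> real"
  assumes rc: "right_complementary N A C"
    and eq: "\<And>n. n \<in> {1..N} \<Longrightarrow> (\<Sum>j = 1..n. A n (n - j) * g j) = v n - v 0"
    and n: "n \<in> {1..N}"
  shows "g n = (\<Sum>k = 1..n. C n (n - k) * (v k - v (k - 1)))"
proof (rule lower_triangular_inj[where A = A and N = N, OF _ _ n])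
  fix m assume "m \<in> {1..N}"
  then show "A m 0 \<noteq> 0"
    using right_complementary_diag[OF rc] by fastforce
next
  fix m assume m: "m \<in> {1..N}"
  define w where "w k = v k - v (k - 1)" for k
  have "(\<Sum>j = 1..m. A m (m - j) * (\<Sum>k = 1..j. C j (j - k) * w k))
      = (\<Sum>j = 1..m. \<Sum>k | k \<in> {1..m} \<and> k \<le> j. A m (m - j) * C j (j - k) * w k)"
    by (auto simp: sum_distrib_left mult.assoc intro!: sum.cong)
  also have "\<dots> = (\<Sum>k = 1..m. \<Sum>j | j \<in> {1..m} \<and> k \<le> j. A m (m - j) * C j (j - k) * w k)"
    by (rule sum.swap_restrict) auto
  also have "\<dots> = (\<Sum>k = 1..m. (\<Sum>j = k..m. A m (m - j) * C j (j - k)) * w k)"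
    by (auto simp: sum_distrib_right intro!: sum.cong)
  also have "\<dots> = (\<Sum>k = 1..m. w k)"
    using right_complementary_sum[OF rc] m by (intro sum.cong) auto
  also have "\<dots> = v m - v 0"
    by (induction m) (auto simp: w_def)
  finally show "(\<Sum>j = 1..m. A m (m - j) * g j)
      = (\<Sum>j = 1..m. A m (m - j) * (\<Sum>k = 1..j. C j (j - k) * (v k - v (k - 1))))"
    using eq[OF m] by (simp add: w_def)
qed

text \<open>
  Subtracting consecutive rows of \<open>g = C w\<close> leaves \<open>(C n 0 - d n) * w n\<close> as a nonnegative
  combination of the earlier entries of \<open>w\<close>. The factor \<open>s\<close> treats both signs at once.
\<close>

lemma increments_keep_sign:
  fixes g w d :: "nat \<Rightarrow> real"
  assumes cm: "column_monotone N C"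
    and g: "\<And>n. n \<in> {1..N} \<Longrightarrow> g n = (\<Sum>k = 1..n. C n (n - k) * w k)"
    and d: "\<And>n. n \<in> {2..N} \<Longrightarrow> g n - g (n - 1) = d n * w n"
    and slope: "\<And>n. n \<in> {2..N} \<Longrightarrow> d n < C n 0"
    and "0 \<le> s * w 1" and "n \<in> {1..N}"
  shows "0 \<le> s * w n"
  using \<open>n \<in> {1..N}\<close>
proof (induction n rule: less_induct)
  case (less n)
  show ?case
  proof (cases "n = 1")
    case True
    then show ?thesis
      using \<open>0 \<le> s * w 1\<close> by simp
  next
    case False
    then obtain m where m: "n = Suc m" "1 \<le> m"
      using less.prems by (cases n) auto
    have n: "n \<in> {2..N}" "m \<in> {1..N}"
      using less.prems m by auto
    have mono: "C n (n - k) \<le> C m (m - k)" if "k \<in> {1..m}" for k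
    proof -
      have "n \<in> {1..N}" "n - k \<in> {1..n - 1}"
        using that less.prems m by auto
      then have "C n (n - k) \<le> C (n - 1) (n - k - 1)"
        using cm unfolding column_monotone_def by blast
      then show ?thesis
        using that m by (simp add: Suc_diff_le)
    qed
    have "g n = (\<Sum>k = 1..m. C n (n - k) * w k) + C n 0 * w n"
      using g[OF less.prems] by (simp add: m)
    with g[OF n(2)] d[OF n(1)]
    have "(C n 0 - d n) * w n = (\<Sum>k = 1..m. (C m (m - k) - C n (n - k)) * w k)"
      by (simp add: m left_diff_distrib sum_subtractf)
    then have "(C n 0 - d n) * (s * w n) = (\<Sum>k = 1..m. (C m (m - k) - C n (n - k)) * (s * w k))"
      by (simp add: mult.left_commute[of _ s] flip: sum_distrib_left)
    also have "\<dots> \<ge> 0"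
    proof (rule sum_nonneg, rule mult_nonneg_nonneg)
      fix k assume k: "k \<in> {1..m}"
      show "0 \<le> C m (m - k) - C n (n - k)"
        using mono[OF k] by simp
      show "0 \<le> s * w k"
        using less k m by simp
    qed
    finally show ?thesis
      using slope[OF n(1)] by (simp add: zero_le_mult_iff)
  qed
qed

lemma difference_eq_bounded_slope:
  fixes f :: "real \<Rightarrow> real"
  assumes diff: "\<And>x. f differentiable at x" and bound: "\<And>x. \<bar>deriv f x\<bar> \<le> M"
  obtains d where "f y - f x = d * (y - x)" "\<bar>d\<bar> \<le> M"
proof -
  have D: "(f has_real_derivative deriv f z) (at z)" for z
    using diff[of z] by (simp add: DERIV_deriv_iff_real_differentiable)
  have slope: "\<exists>z. f y - f x = deriv f z * (y - x)" if "x < y" for x y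
    using MVT2[OF that, of f "deriv f"] D by (auto simp: mult.commute)
  consider "x < y" | "x = y" | "y < x"
    by linarith
  then have "\<exists>z. f y - f x = deriv f z * (y - x)"
  proof cases
    case 1
    then show ?thesis by (rule slope)
  next
    case 2
    then show ?thesis by simp
  next
    case 3
    then obtain z where "f x - f y = deriv f z * (x - y)"
      using slope by blast
    then have "f y - f x = deriv f z * (y - x)"
      by (simp add: algebra_simps)
    then show ?thesis ..
  qed
  with bound that show ?thesis
    by blast
qed

lemma mono_on_atMost_if_increments_nonneg:
  fixes u :: "nat \<Rightarrow> real"
  assumes "\<And>n. n \<in> {1..N} \<Longrightarrow> u (n - 1) \<le> u n"
  shows "mono_on {0..N} u"
proof (rule mono_onI)
  fix r s assume "r \<in> {0..N}" "s \<in> {0..N}" "r \<le> s"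
  from \<open>r \<le> s\<close> \<open>s \<in> {0..N}\<close> show "u r \<le> u s"
  proof (induction s rule: dec_induct)
    case (step n)
    then show ?case
      using assms[of "Suc n"] by force
  qed simp
qed

theorem theorem5p2:
  fixes N :: nat and t \<tau> u :: "nat \<Rightarrow> real" and T u0 M :: real
    and f :: "real \<Rightarrow> real" and a abar :: array_kernel
  assumes "1 \<le> N"
    and "t 0 = 0" and "t N = T" and "\<forall>n\<in>{1..N}. t (n - 1) < t n"
    and "\<forall>n\<in>{1..N}. \<tau> n = t n - t (n - 1)"
    and "smooth f" and "\<exists>K. K-lipschitz_on UNIV f"
    and "M > 0" and "\<forall>v. \<bar>deriv f v\<bar> \<le> M"
    and "\<forall>n\<in>{1..N}. \<forall>j\<in>{1..n}. a n (n - j) = abar n (n - j) * \<tau> j"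
    and "local_R_CMM N a"
    and "M * (SUP j\<in>{1..N}. a j 0) < 1"
    and "u 0 = u0"
    and "\<forall>n\<in>{1..N}. u n = u0 + (\<Sum>j = 1..n. a n (n - j) * f (u j))"
  shows "mono_on {0..N} u \<or> antimono_on {0..N} u"
proof -
  have "smooth f" and bound: "\<bar>deriv f x\<bar> \<le> M" for x
    using assms by auto
  have diff: "f differentiable at x" for x
    using \<open>smooth f\<close> unfolding smooth_def by (metis funpow_0)
  obtain C where rc: "right_complementary N a C" and C: "column_monotone N C"
    using assms(11) by (auto simp: local_R_CMM_def doubly_monotone_def)
  define w where "w n = u n - u (n - 1)" for n

  have "\<exists>d. f (u n) - f (u (n - 1)) = d * w n \<and> \<bar>d\<bar> \<le> M" for n
    using difference_eq_bounded_slope[OF diff bound] unfolding w_def by metis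
  then obtain d where d: "f (u n) - f (u (n - 1)) = d n * w n" and dM: "\<bar>d n\<bar> \<le> M" for n
    by metis

  have scheme: "(\<Sum>j = 1..n. a n (n - j) * f (u j)) = u n - u 0" if "n \<in> {1..N}" for n
    using assms(13,14) that by auto
  have fu: "f (u n) = (\<Sum>k = 1..n. C n (n - k) * w k)" if "n \<in> {1..N}" for n
    unfolding w_def by (rule solve_by_right_complementary[OF rc scheme that])

  have less: "d n < C n 0" if n: "n \<in> {1..N}" for n
  proof -
    have "a n (n - n) \<ge> 0"
      using assms(11) n unfolding local_R_CMM_def column_monotone_def nonneg_kernel_def
      by (metis atLeastAtMost_iff le_refl)
    moreover have inv: "a n 0 * C n 0 = 1"
      by (rule right_complementary_diag[OF rc n])
    ultimately have pos: "a n 0 > 0"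
      by (auto simp: less_le)
    have "a n 0 \<le> (SUP j\<in>{1..N}. a j 0)"
      using n by (intro cSUP_upper) auto
    then have "M * a n 0 < 1"
      using \<open>M > 0\<close> assms(12) by (smt (verit) mult_left_mono)
    then have "a n 0 * M < a n 0 * C n 0"
      using inv by (simp add: mult.commute)
    then have "M < C n 0"
      using pos by simp
    then show ?thesis
      using dM[of n] by linarith
  qed

  have sign: "0 \<le> s * w n" if "0 \<le> s * w 1" "n \<in> {1..N}" for s n
    by (rule increments_keep_sign[OF C fu _ _ that, where d = d]) (use d less in auto)

  show ?thesis
  proof (cases "0 \<le> w 1")
    case True
    then have "mono_on {0..N} u"
      using sign[of 1] by (intro mono_on_atMost_if_increments_nonneg) (simp add: w_def)
    then show ?thesis ..
  next
    case False
    then have "mono_on {0..N} (\<lambda>n. - u n)"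
      using sign[of "-1"] by (intro mono_on_atMost_if_increments_nonneg) (simp add: w_def)
    then have "antimono_on {0..N} u"
      by (auto simp: monotone_on_def)
    then show ?thesis ..
  qed
qed

end
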